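(* Let $G$ and $H$ be finite, simple, connected graphs, each with at least two vertices, such that $G$ has no simplicial vertices. Then $h(G\boxtimes H)\le h(G)$.
   Context: A vertex $v$ is simplicial if its neighborhood induces a complete graph. For a connected graph $G$, the closed interval $I[x,y]$ consists of $x$, $y$ and all vertices on some shortest $x$–$y$ path; for $S\subseteq V(G)$, $I[S]=\bigcup_{u,v\in S}I[u,v]$. A set is convex if $I[S]=S$; the convex hull $CH(S)$ is the smallest convex set containing $S$. $S$ is a hull set if $CH(S)=V(G)$; $h(G)$ is the minimum cardinality of a hull set. The strong product $G\boxtimes H$ has vertex set $V(G)\times V(H)$, with $(g,h)$ and $(g',h')$ adjacent whenever ($g=g'$ and $hh'\in E(H)$), or ($h=h'$ and $gg'\in E(G)$), or ($gg'\in E(G)$ and $hh'\in E(H)$). *)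

theory Defs
  imports "Graph_Theory.Graph_Theory" "Graph_Theory.Kuratowski"
begin

text \<open>
  A finite simple graph is a \<^locale>\<open>pair_graph\<close>: an edge \<open>uv\<close> is the pair of arcs \<open>(u,v)\<close>, \<open>(v,u)\<close>.
\<close>

definition neighborhood :: "'a pair_pre_digraph \<Rightarrow> 'a \<Rightarrow> 'a set" where
  "neighborhood G v = {u. (v, u) \<in> parcs G}"

definition simplicial :: "'a pair_pre_digraph \<Rightarrow> 'a \<Rightarrow> bool" where
  "simplicial G v \<longleftrightarrow>
     v \<in> pverts G \<and>
     complete_digraph (card (neighborhood G v)) (with_proj G \<restriction> neighborhood G v)"

lemma (in pair_graph) simplicial_iff:
  "simplicial G v \<longleftrightarrow>
     v \<in> pverts G \<and>
     (\<forall>x\<in>neighborhood G v. \<forall>y\<in>neighborhood G v. x \<noteq> y \<longrightarrow> (x, y) \<in> parcs G)"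
proof -
  let ?N = "neighborhood G v"
  let ?I = "\<lparr>pverts = ?N, parcs = {e \<in> parcs G. fst e \<in> ?N \<and> snd e \<in> ?N}\<rparr>"
  have fin: "finite ?N"
    by (rule finite_subset[OF _ finite_verts]) (auto simp: neighborhood_def dest: in_arcsD2)
  have eq: "with_proj G \<restriction> ?N = with_proj ?I"
    by (simp add: induce_subgraph_def with_proj_def)
  have "complete_digraph (card ?N) (with_proj G \<restriction> ?N) \<longleftrightarrow>
      {e \<in> parcs G. fst e \<in> ?N \<and> snd e \<in> ?N} = {(x, y). (x, y) \<in> ?N \<times> ?N \<and> x \<noteq> y}"
    unfolding eq complete_digraph_pair_def using fin by simp
  also have "\<dots> \<longleftrightarrow> (\<forall>x\<in>?N. \<forall>y\<in>?N. x \<noteq> y \<longrightarrow> (x, y) \<in> parcs G)"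
    by (auto dest: no_loops')
  finally show ?thesis
    by (simp add: simplicial_def)
qed

definition shortest_path :: "'a pair_pre_digraph \<Rightarrow> 'a \<Rightarrow> ('a \<times> 'a) awalk \<Rightarrow> 'a \<Rightarrow> bool" where
  "shortest_path G x p y \<longleftrightarrow>
     pre_digraph.apath (with_proj G) x p y \<and>
     (\<forall>q. pre_digraph.apath (with_proj G) x q y \<longrightarrow> length p \<le> length q)"

definition interval :: "'a pair_pre_digraph \<Rightarrow> 'a \<Rightarrow> 'a \<Rightarrow> 'a set" where
  "interval G x y =
     {x, y} \<union> {z. \<exists>p. shortest_path G x p y \<and> z \<in> set (pre_digraph.awalk_verts (with_proj G) x p)}"

definition interval_closure :: "'a pair_pre_digraph \<Rightarrow> 'a set \<Rightarrow> 'a set" where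
  "interval_closure G S = (\<Union>u\<in>S. \<Union>v\<in>S. interval G u v)"

definition geodesically_convex :: "'a pair_pre_digraph \<Rightarrow> 'a set \<Rightarrow> bool" where
  "geodesically_convex G S \<longleftrightarrow> S \<subseteq> pverts G \<and> interval_closure G S = S"

text \<open>
  The generic \<^const>\<open>hull\<close> is an intersection of convex sets; \<open>convex_hull_least\<close> below shows that
  it is the smallest convex set containing \<open>S\<close>.
\<close>

definition convex_hull :: "'a pair_pre_digraph \<Rightarrow> 'a set \<Rightarrow> 'a set" where
  "convex_hull G S = geodesically_convex G hull S"

definition hull_set :: "'a pair_pre_digraph \<Rightarrow> 'a set \<Rightarrow> bool" where
  "hull_set G S \<longleftrightarrow> S \<subseteq> pverts G \<and> convex_hull G S = pverts G"

definition hull_number :: "'a pair_pre_digraph \<Rightarrow> nat" where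
  "hull_number G = Min (card ` {S. hull_set G S})"

definition strong_product ::
  "'a pair_pre_digraph \<Rightarrow> 'b pair_pre_digraph \<Rightarrow> ('a \<times> 'b) pair_pre_digraph" (infixl \<open>\<boxtimes>\<close> 70) where
  "G \<boxtimes> H =
     \<lparr>pverts = pverts G \<times> pverts H,
      parcs = {((g, h), (g', h')) | g h g' h'.
        (g, h) \<in> pverts G \<times> pverts H \<and> (g', h') \<in> pverts G \<times> pverts H \<and>
        (g = g' \<and> (h, h') \<in> parcs H \<or>
         h = h' \<and> (g, g') \<in> parcs G \<or>
         (g, g') \<in> parcs G \<and> (h, h') \<in> parcs H)}\<rparr>"

lemma subset_interval_closure: "S \<subseteq> interval_closure G S"
  by (auto simp: interval_closure_def interval_def)

lemma interval_closure_mono: "S \<subseteq> T \<Longrightarrow> interval_closure G S \<subseteq> interval_closure G T"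
  by (auto simp: interval_closure_def)

lemma (in pair_wf_digraph) geodesically_convex_pverts: "geodesically_convex G (pverts G)"
proof -
  have "interval G u v \<subseteq> pverts G" if "u \<in> pverts G" "v \<in> pverts G" for u v
    using that awalk_verts_in_verts
    by (fastforce simp: interval_def shortest_path_def apath_def awalk_def)
  then show ?thesis
    using subset_interval_closure[of "pverts G" G]
    by (auto simp: geodesically_convex_def interval_closure_def)
qed

lemma geodesically_convex_Inter:
  assumes "\<C> \<noteq> {}" "\<And>C. C \<in> \<C> \<Longrightarrow> geodesically_convex G C"
  shows "geodesically_convex G (\<Inter>\<C>)"
proof -
  have "interval_closure G (\<Inter>\<C>) \<subseteq> C" if "C \<in> \<C>" for C
    using interval_closure_mono[of "\<Inter>\<C>" C G] that assms(2)[OF that]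
    by (auto simp: geodesically_convex_def)
  then show ?thesis
    using assms subset_interval_closure[of "\<Inter>\<C>" G]
    by (fastforce simp: geodesically_convex_def)
qed

lemma (in pair_wf_digraph) convex_hull_least:
  assumes "S \<subseteq> pverts G"
  shows "geodesically_convex G (convex_hull G S)" "S \<subseteq> convex_hull G S"
    "\<And>C. geodesically_convex G C \<Longrightarrow> S \<subseteq> C \<Longrightarrow> convex_hull G S \<subseteq> C"
  using assms geodesically_convex_pverts
  by (auto simp: convex_hull_def hull_def intro!: geodesically_convex_Inter)

lemma (in pair_fin_digraph) hull_number_attained:
  shows "\<exists>S. hull_set G S \<and> card S = hull_number G"
    and "\<And>S. hull_set G S \<Longrightarrow> hull_number G \<le> card S"
proof -
  have "hull_set G (pverts G)"
    by (simp add: hull_set_def convex_hull_def hull_same geodesically_convex_pverts)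
  moreover have fin: "finite {S. hull_set G S}"
    by (rule finite_subset[of _ "Pow (pverts G)"]) (auto simp: hull_set_def pair_finite_verts)
  ultimately show "\<exists>S. hull_set G S \<and> card S = hull_number G"
    using Min_in[of "card ` {S. hull_set G S}"] unfolding hull_number_def by fastforce
  show "\<And>S. hull_set G S \<Longrightarrow> hull_number G \<le> card S"
    using fin by (simp add: hull_number_def)
qed

lemma pair_graph_strong_product:
  assumes "pair_graph G" "pair_graph H"
  shows "pair_graph (G \<boxtimes> H)"
proof -
  interpret G: pair_graph G by fact
  interpret H: pair_graph H by fact
  have fin: "finite (pverts (G \<boxtimes> H))"
    by (simp add: strong_product_def)
  have "parcs (G \<boxtimes> H) \<subseteq> pverts (G \<boxtimes> H) \<times> pverts (G \<boxtimes> H)"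
    by (auto simp: strong_product_def)
  then have "finite (parcs (G \<boxtimes> H))"
    using fin by (meson finite_SigmaI finite_subset)
  then show ?thesis
    using fin
    by unfold_locales
      (auto simp: strong_product_def symmetric_def intro!: symI
        dest: G.no_loops' H.no_loops' G.arcs_symmetric H.arcs_symmetric)
qed

end

theory Submission
  imports Defs
begin

text \<open>
  Fix a vertex \<open>h\<close> of \<open>H\<close> and a minimum hull set \<open>S\<close> of \<open>G\<close>; the set \<open>S \<times> {h}\<close> is a hull set of the
  strong product. Projecting walks to \<open>G\<close> does not lengthen them, so the \<open>G\<close>-layer at \<open>h\<close> is
  isometric and a convex set \<open>C\<close> containing \<open>S \<times> {h}\<close> contains the whole layer. Every vertex \<open>g\<close> of
  \<open>G\<close> has two non-adjacent neighbours \<open>x\<close>, \<open>y\<close>, and for an edge \<open>hh'\<close> the vertex \<open>(g, h')\<close> lies on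
  a shortest path between \<open>(x, h)\<close> and \<open>(y, h)\<close>. Hence \<open>C\<close> contains the layer at \<open>h'\<close> too, and
  connectedness of \<open>H\<close> spreads this to all layers.
\<close>

text \<open>Each step of the reduction cuts a closed subwalk out of the walk. Projected walks may
  repeat vertices, whereas \<open>shortest_path\<close> compares paths only; this bound bridges the
  two.\<close>

lemma (in pair_wf_digraph) awalk_to_apath_length_le:
  assumes "awalk u p v"
  shows "length (awalk_to_apath p) \<le> length p"
  using assms
proof (induct rule: awalk_to_apath_induct)
  case (path p)
  then show ?case by (auto simp: awalk_to_apath.simps)
next
  case (decomp p q r s)
  then show ?case
    using step_awalk_to_apath[of u p v q r s] by (auto elim!: awalk_cyc_decompE)
qed

lemma pverts_strong_product [simp]: "pverts (G \<boxtimes> H) = pverts G \<times> pverts H"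
  by (simp add: strong_product_def)

lemma geodesically_convexD:
  assumes "geodesically_convex G C" "x \<in> C" "y \<in> C" "shortest_path G x p y"
    "z \<in> set (pawalk_verts x p)"
  shows "z \<in> C"
proof -
  have "z \<in> interval G x y"
    using assms(4,5) by (auto simp: interval_def awalk_verts_with_proj_eq)
  then have "z \<in> interval_closure G C"
    using assms(2,3) by (auto simp: interval_closure_def)
  then show ?thesis using assms(1) by (simp add: geodesically_convex_def)
qed

lemma geodesically_convexI:
  assumes "C \<subseteq> pverts G"
    and "\<And>x y p z. \<lbrakk>x \<in> C; y \<in> C; shortest_path G x p y; z \<in> set (pawalk_verts x p)\<rbrakk> \<Longrightarrow> z \<in> C"
  shows "geodesically_convex G C"
proof -
  have "interval G x y \<subseteq> C" if "x \<in> C" "y \<in> C" for x y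
    using that assms(2)[OF that] by (auto simp: interval_def awalk_verts_with_proj_eq)
  then have "interval_closure G C \<subseteq> C" by (auto simp: interval_closure_def)
  then show ?thesis
    using assms(1) subset_interval_closure[of C G] by (auto simp: geodesically_convex_def)
qed

lemma (in pair_wf_digraph) hull_setI:
  assumes "S \<subseteq> pverts G"
    and "\<And>C. geodesically_convex G C \<Longrightarrow> S \<subseteq> C \<Longrightarrow> pverts G \<subseteq> C"
  shows "hull_set G S"
  using assms convex_hull_least(1,2)[OF assms(1)]
  by (auto simp: hull_set_def geodesically_convex_def)

lemma (in pair_wf_digraph) hull_setD:
  assumes "hull_set G S" "geodesically_convex G C" "S \<subseteq> C"
  shows "pverts G \<subseteq> C"
  using convex_hull_least(3)[OF _ assms(2,3)] assms(1) by (simp add: hull_set_def)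

locale strong_product_graphs = G: pair_graph G + H: pair_graph H
  for G :: "'a pair_pre_digraph" and H :: "'b pair_pre_digraph"
begin

sublocale P: pair_graph "G \<boxtimes> H"
  using pair_graph_strong_product G.pair_graph H.pair_graph .

abbreviation layer_path :: "'b \<Rightarrow> ('a \<times> 'a) awalk \<Rightarrow> (('a \<times> 'b) \<times> ('a \<times> 'b)) awalk" where
  "layer_path h \<equiv> map (\<lambda>(u, v). ((u, h), (v, h)))"

lemma pawalk_verts_layer_path:
  "pawalk_verts (u, h) (layer_path h p) = map (\<lambda>g. (g, h)) (pawalk_verts u p)"
  by (induct p arbitrary: u) auto

lemma layer_arc:
  assumes "(u, v) \<in> parcs G" "h \<in> pverts H"
  shows "((u, h), (v, h)) \<in> parcs (G \<boxtimes> H)"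
  using assms by (auto simp: strong_product_def dest: G.in_arcsD1 G.in_arcsD2)

lemma awalk_layer_path:
  assumes "G.awalk u p v" "h \<in> pverts H"
  shows "P.awalk (u, h) (layer_path h p) (v, h)"
  using assms
proof (induct p arbitrary: u)
  case Nil
  then show ?case
    by (auto simp: G.awalk_Nil_iff P.awalk_Nil_iff)
next
  case (Cons e p)
  then show ?case
    using layer_arc by (cases e) (simp add: G.awalk_Cons_iff P.awalk_Cons_iff)
qed

lemma apath_layer_path:
  assumes "G.apath u p v" "h \<in> pverts H"
  shows "P.apath (u, h) (layer_path h p) (v, h)"
  using assms awalk_layer_path[of u p v h]
  by (simp add: G.apath_def P.apath_def pawalk_verts_layer_path distinct_map inj_on_def)

text \<open>Along an arc of the product the first coordinate either stays fixed or follows an arc of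
  \<open>G\<close>; dropping the fixed steps leaves a walk in \<open>G\<close>.\<close>

lemma awalk_project:
  assumes "P.awalk u q v"
  shows "\<exists>p. G.awalk (fst u) p (fst v) \<and> length p \<le> length q"
  using assms
proof (induct q arbitrary: u)
  case Nil
  then have "G.awalk (fst u) [] (fst v)"
    by (auto simp: P.awalk_Nil_iff G.awalk_Nil_iff)
  then show ?case by force
next
  case (Cons e q)
  obtain g h g' h' where e: "e = ((g, h), (g', h'))" by (metis surj_pair)
  with Cons.prems have arc: "((g, h), (g', h')) \<in> parcs (G \<boxtimes> H)" and u: "u = (g, h)"
    and "P.awalk (g', h') q v"
    by (simp_all add: P.awalk_Cons_iff)
  then obtain p where p: "G.awalk g' p (fst v)" "length p \<le> length q"
    using Cons.hyps[of "(g', h')"] by auto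
  from arc have "g = g' \<or> (g, g') \<in> parcs G" by (auto simp: strong_product_def)
  then show ?case
  proof
    assume "g = g'"
    \<comment> \<open>The arc moves only in \<open>H\<close>, so \<open>p\<close> itself serves as
      the projection.\<close>
    then show ?thesis using p u le_SucI by auto
  next
    assume "(g, g') \<in> parcs G"
    then have "G.awalk (fst u) ((g, g') # p) (fst v)" using p u by (simp add: G.awalk_Cons_iff)
    then show ?thesis using p by (metis Suc_le_mono length_Cons)
  qed
qed

lemma shortest_path_layer_path:
  assumes "shortest_path G u p v" "h \<in> pverts H"
  shows "shortest_path (G \<boxtimes> H) (u, h) (layer_path h p) (v, h)"
proof -
  have "length p \<le> length q" if q: "P.apath (u, h) q (v, h)" for q
  proof -
    obtain r where r: "G.awalk u r v" "length r \<le> length q"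
      using awalk_project[of "(u, h)" q "(v, h)"] q by (auto simp: P.apath_def)
    then have "length p \<le> length (G.awalk_to_apath r)"
      using assms(1) G.apath_awalk_to_apath by (simp add: shortest_path_def)
    then show ?thesis using G.awalk_to_apath_length_le[OF r(1)] r(2) by simp
  qed
  then show ?thesis
    using assms apath_layer_path by (simp add: shortest_path_def)
qed

text \<open>A shortest path of \<open>G\<close> copied into the layer at \<open>h\<close> is still
  shortest, so convexity of \<open>C\<close> captures its vertices.\<close>

lemma geodesically_convex_layer:
  assumes "geodesically_convex (G \<boxtimes> H) C" "h \<in> pverts H"
  shows "geodesically_convex G {g. (g, h) \<in> C}"
proof (rule geodesically_convexI)
  show "{g. (g, h) \<in> C} \<subseteq> pverts G"
    using assms(1) by (auto simp: geodesically_convex_def)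
next
  fix x y p z
  assume ends: "x \<in> {g. (g, h) \<in> C}" "y \<in> {g. (g, h) \<in> C}"
    and p: "shortest_path G x p y" and z: "z \<in> set (pawalk_verts x p)"
  have "(z, h) \<in> set (pawalk_verts (x, h) (layer_path h p))"
    using z by (simp add: pawalk_verts_layer_path image_iff)
  with ends have "(z, h) \<in> C"
    using geodesically_convexD[OF assms(1) _ _ shortest_path_layer_path[OF p assms(2)]]
    by blast
  then show "z \<in> {g. (g, h) \<in> C}" by simp
qed

text \<open>The diagonal arcs of the strong product make \<open>(g, h')\<close> a common neighbour
  of two vertices at distance 2. This is how a convex set passes from one layer to the next.\<close>

lemma shortest_path_through_adjacent_layer:
  assumes "(g, x) \<in> parcs G" "(g, y) \<in> parcs G" "x \<noteq> y" "(x, y) \<notin> parcs G"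
    and "(h, h') \<in> parcs H"
  shows "shortest_path (G \<boxtimes> H) (x, h) [((x, h), (g, h')), ((g, h'), (y, h))] (y, h)"
proof -
  have arcs: "((x, h), (g, h')) \<in> parcs (G \<boxtimes> H)" "((g, h'), (y, h)) \<in> parcs (G \<boxtimes> H)"
    using assms G.arcs_symmetric H.arcs_symmetric
    by (auto simp: strong_product_def dest: G.in_arcsD1 G.in_arcsD2 H.in_arcsD1 H.in_arcsD2)
  then have "P.apath (x, h) [((x, h), (g, h')), ((g, h'), (y, h))] (y, h)"
    using assms P.in_arcsD2[OF arcs(2)]
    by (auto simp: P.apath_def P.awalk_simps dest: G.no_loops' H.no_loops')
  moreover have "2 \<le> length q" if "P.apath (x, h) q (y, h)" for q
  proof (rule ccontr)
    assume "\<not> 2 \<le> length q"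
    then consider "q = []" | e where "q = [e]"
      by (cases q; cases "tl q") auto
    then show False
    proof cases
      case 1
      then show False using that assms(3) by (simp add: P.apath_Nil_iff)
    next
      case (2 e)
      then have "((x, h), (y, h)) \<in> parcs (G \<boxtimes> H)"
        using that by (cases e) (auto simp: P.apath_def P.awalk_simps)
      \<comment> \<open>Both ends have second coordinate \<open>h\<close>, and \<open>H\<close> has
        no loop there, so such an arc could only come from an arc \<open>(x, y)\<close> of
        \<open>G\<close>.\<close>
      then show False
        using assms(3,4) by (auto simp: strong_product_def dest: H.no_loops')
    qed
  qed
  ultimately show ?thesis by (auto simp: shortest_path_def numeral_2_eq_2)
qed

lemma hull_set_layer:
  assumes "Digraph_Component.connected (with_proj H)" "h \<in> pverts H"
    and no_simplicial: "\<not> (\<exists>v\<in>pverts G. simplicial G v)"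
    and "hull_set G S"
  shows "hull_set (G \<boxtimes> H) (S \<times> {h})"
proof (rule P.hull_setI)
  show "S \<times> {h} \<subseteq> pverts (G \<boxtimes> H)"
    using assms by (auto simp: hull_set_def)
next
  fix C assume C: "geodesically_convex (G \<boxtimes> H) C" "S \<times> {h} \<subseteq> C"
  have "pverts G \<times> {k} \<subseteq> C" if "k \<in> pverts H" for k
  proof -
    \<comment> \<open>Connectedness refers to the symmetric closure; as the arcs of \<open>H\<close>
      are symmetric, it yields directed reachability, along which the layers are filled by
      induction.\<close>
    have "h \<rightarrow>\<^sup>*\<^bsub>with_proj H\<^esub> k"
      using H.symmetric_connected_imp_strongly_connected[OF H.sym_arcs assms(1)] assms(2) that
      by (auto simp: strongly_connected_def)
    then show ?thesis
    proof (induct rule: H.reachable_induct)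
      case base
      show ?case
        \<comment> \<open>The slice of \<open>C\<close> at \<open>h\<close> is convex in
          \<open>G\<close> and contains the hull set \<open>S\<close>.\<close>
        using G.hull_setD[OF assms(4) geodesically_convex_layer[OF C(1) assms(2)]] C(2) by auto
    next
      case (step k k')
      have "(g, k') \<in> C" if g: "g \<in> pverts G" for g
      proof -
        obtain x y where xy: "(g, x) \<in> parcs G" "(g, y) \<in> parcs G" "x \<noteq> y" "(x, y) \<notin> parcs G"
          using no_simplicial g by (auto simp: G.simplicial_iff neighborhood_def)
        have k: "(k, k') \<in> parcs H" using step by simp
        \<comment> \<open>The induction hypothesis gives the whole layer at \<open>k\<close>, in
          particular these two endpoints.\<close>
        have "(x, k) \<in> C" "(y, k) \<in> C"
          using step xy by (auto dest: G.in_arcsD2)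
        from geodesically_convexD[OF C(1) this shortest_path_through_adjacent_layer[OF xy k]]
        show ?thesis by simp
      qed
      then show ?case by auto
    qed
  qed
  then show "pverts (G \<boxtimes> H) \<subseteq> C" by auto
qed

end

theorem theorem3:
  fixes G :: "'a pair_pre_digraph" and H :: "'b pair_pre_digraph"
  assumes "pair_graph G" and "pair_graph H"
    and "Digraph_Component.connected (with_proj G)"
    and "Digraph_Component.connected (with_proj H)"
    and "card (pverts G) \<ge> 2" and "card (pverts H) \<ge> 2"
    and "\<not> (\<exists>v\<in>pverts G. simplicial G v)"
  shows "hull_number (G \<boxtimes> H) \<le> hull_number G"
proof -
  interpret G: pair_graph G by fact
  interpret H: pair_graph H by fact
  interpret strong_product_graphs G H ..
  obtain h where "h \<in> pverts H" using assms(6) by fastforce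
  moreover obtain S where "hull_set G S" "card S = hull_number G"
    using G.hull_number_attained(1) by blast
  \<comment> \<open>\<open>S \<times> {h}\<close> has the same cardinality as
    \<open>S\<close>.\<close>
  ultimately show ?thesis
    using P.hull_number_attained(2)[OF hull_set_layer[OF assms(4) _ assms(7)]]
    by (fastforce simp: card_cartesian_product)
qed

end
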